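(* Let $r$ and $w$ be positive integers. If $(T,L)$ is a branch decomposition of a digraph $G$ of bi-mim-width $w$, then $(T,L)$, regarded as a branch decomposition of $G^r$, has bi-mim-width at most $rw$.
   Context: Digraphs are finite, have no multiple edges, and may have loops; $E(G)\subseteq V(G)\times V(G)$. The $r$-th power $G^r$ is the digraph obtained from $G$ by adding, for every pair $(x,y)$ of vertices, an edge from $x$ to $y$ if there is a directed path of length at most $r$ from $x$ to $y$ in $G$. For disjoint $A,B\subseteq V(G)$, $G[A\to B]$ is the bipartite digraph on $A\cup B$ with edge set $E(G)\cap(A\times B)$; $\bar A=V(G)\setminus A$. An induced matching is a set $M$ of edges, no two sharing an endpoint, such that no edge of the digraph meets two distinct edges of $M$; $\nu(\cdot)$ is the maximum size of an induced matching. Let $\mathrm{bimim}_G(A)=\nu(G[A\to\bar A])+\nu(G[\bar A\to A])$. A tree is subcubic if it has at least two vertices and every internal vertex has degree $3$. A branch decomposition of $G$ is a pair $(T,L)$ of a subcubic tree $T$ and a bijection $L$ from $V(G)$ to the leaves of $T$. Each edge $e$ of $T$ yields a cut $(A_e,B_e)$ of $G$, where $A_e,B_e$ are the sets of vertices mapped by $L$ to the leaves in the two components of $T-e$. The bi-mim-width of $(T,L)$ (with respect to $G$) is $\max_{e\in E(T)}\mathrm{bimim}_G(A_e)$. *)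

theory Defs
  imports "Graph_Theory.Graph_Theory"
begin

(* Digraphs are values of type 'a pair_pre_digraph satisfying pair_fin_digraph: finite, arcs are
   pairs of vertices (hence no multiple edges), loops allowed. *)

(* The paths of length 0 only add loops, which never cross a cut. *)
definition digraph_power :: "'a pair_pre_digraph \<Rightarrow> nat \<Rightarrow> 'a pair_pre_digraph" where
  "digraph_power G r =
     \<lparr> pverts = pverts G,
       parcs = parcs G \<union>
         {(x, y). x \<in> pverts G \<and> y \<in> pverts G \<and>
            (\<exists>p. pre_digraph.apath (with_proj G) x p y \<and> length p \<le> r)} \<rparr>"

definition arcs_between :: "'a pair_pre_digraph \<Rightarrow> 'a set \<Rightarrow> 'a set \<Rightarrow> 'a pair_pre_digraph" where
  "arcs_between G A B = \<lparr> pverts = A \<union> B, parcs = parcs G \<inter> (A \<times> B) \<rparr>"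

definition endpoints :: "'a \<times> 'a \<Rightarrow> 'a set" where
  "endpoints e = {fst e, snd e}"

definition induced_matching :: "'a pair_pre_digraph \<Rightarrow> ('a \<times> 'a) set \<Rightarrow> bool" where
  "induced_matching H M \<longleftrightarrow>
     M \<subseteq> parcs H \<and>
     (\<forall>e\<in>M. \<forall>f\<in>M. e \<noteq> f \<longrightarrow>
        endpoints e \<inter> endpoints f = {} \<and>
        \<not> (\<exists>g\<in>parcs H. endpoints g \<inter> endpoints e \<noteq> {} \<and> endpoints g \<inter> endpoints f \<noteq> {}))"

definition induced_matching_number :: "'a pair_pre_digraph \<Rightarrow> nat" where
  "induced_matching_number H = Max (card ` {M. induced_matching H M})"

definition bimim :: "'a pair_pre_digraph \<Rightarrow> 'a set \<Rightarrow> nat" where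
  "bimim G A =
     induced_matching_number (arcs_between G A (pverts G - A)) +
     induced_matching_number (arcs_between G (pverts G - A) A)"

(* Undirected simple graphs are symmetric loop-free digraphs (pair_graph). There the closed walk
   u, v, u is a cycle in the sense of pre_digraph.cycle, so the library's constant tree, which
   forbids all directed cycles, does not describe undirected trees; undirected cycles are the
   directed cycles of length at least 3. *)
definition undirected_tree :: "'b pair_pre_digraph \<Rightarrow> bool" where
  "undirected_tree T \<longleftrightarrow>
     pair_graph T \<and> connected (with_proj T) \<and>
     \<not> (\<exists>p. pre_digraph.cycle (with_proj T) p \<and> 3 \<le> length p)"

(* In a symmetric digraph the out-degree is the degree of the undirected graph. *)
definition leaves :: "'b pair_pre_digraph \<Rightarrow> 'b set" where
  "leaves T = {v \<in> pverts T. out_degree (with_proj T) v = 1}"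

definition subcubic_tree :: "'b pair_pre_digraph \<Rightarrow> bool" where
  "subcubic_tree T \<longleftrightarrow>
     undirected_tree T \<and> 2 \<le> card (pverts T) \<and>
     (\<forall>v \<in> pverts T - leaves T. out_degree (with_proj T) v = 3)"

definition branch_decomposition ::
    "'a pair_pre_digraph \<Rightarrow> 'b pair_pre_digraph \<Rightarrow> ('a \<Rightarrow> 'b) \<Rightarrow> bool" where
  "branch_decomposition G T L \<longleftrightarrow> subcubic_tree T \<and> bij_betw L (pverts G) (leaves T)"

definition delete_edge :: "'b pair_pre_digraph \<Rightarrow> 'b \<times> 'b \<Rightarrow> 'b pair_pre_digraph" where
  "delete_edge T e = \<lparr> pverts = pverts T, parcs = parcs T - {(fst e, snd e), (snd e, fst e)} \<rparr>"

(* The side of the cut induced by T - e that belongs to the component containing fst e. *)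
definition cut_side ::
    "'a pair_pre_digraph \<Rightarrow> 'b pair_pre_digraph \<Rightarrow> ('a \<Rightarrow> 'b) \<Rightarrow> 'b \<times> 'b \<Rightarrow> 'a set" where
  "cut_side G T L e = {x \<in> pverts G. fst e \<rightarrow>\<^sup>*\<^bsub>with_proj (delete_edge T e)\<^esub> L x}"

(* Every edge of T occurs as two opposite arcs; they give the two sides of the same cut, for
   which bimim has the same value. *)
definition bi_mim_width ::
    "'a pair_pre_digraph \<Rightarrow> 'b pair_pre_digraph \<Rightarrow> ('a \<Rightarrow> 'b) \<Rightarrow> nat" where
  "bi_mim_width G T L = Max ((\<lambda>e. bimim G (cut_side G T L e)) ` parcs T)"

end

theory Submission
  imports Defs
begin

text \<open>
  Why the bound holds. The cuts of a branch decomposition depend on the vertex set only, so it is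
  enough to compare, on a single cut \<open>(A, V - A)\<close>, the induced matching numbers of \<open>G\<close> and of its
  power, in each of the two directions separately.

  Let \<open>M\<close> be an induced matching of the power across the cut. Every arc \<open>(a, b)\<close> of \<open>M\<close> comes from a
  walk of length at most \<open>r\<close> in \<open>G\<close>, which has to traverse an arc \<open>(x, y)\<close> of \<open>G\<close> from \<open>A\<close> to
  \<open>V - A\<close>; let \<open>i < r\<close> be the position of such a crossing arc on the walk. Split \<open>M\<close> into at most
  \<open>r\<close> classes according to \<open>i\<close>. Within one class the crossing arcs form an induced matching of
  \<open>G\<close>: if \<open>(a, b)\<close> and \<open>(a', b')\<close> have crossing arcs \<open>(x, y)\<close> and \<open>(x', y')\<close> at the same position
  and \<open>(x, y')\<close> is an arc of \<open>G\<close>, then following the first walk up to \<open>x\<close>, taking \<open>(x, y')\<close> and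
  continuing on the second walk gives a walk from \<open>a\<close> to \<open>b'\<close> of length at most \<open>r\<close>, because
  the initial part has the length of the corresponding part of the second walk. So \<open>(a, b')\<close> is an
  arc of the power, and since \<open>M\<close> is an induced matching the two arcs are equal. Hence each class
  has at most as many arcs as a maximum induced matching of \<open>G\<close> across the cut
  (\<open>induced_matching_number_power_le\<close>).
\<close>

section \<open>Induced matchings across a cut\<close>

text \<open>
  In a bipartite digraph with all arcs directed from one side to the other, sharing an endpoint is a
  special case of being joined by an arc: if \<open>e\<close> and \<open>f\<close> have the same tail, then
  \<open>(fst e, snd f)\<close> is \<open>f\<close>. So a single condition characterises induced matchings.
\<close>

lemma induced_matching_arcs_between_iff:
  assumes "A \<inter> B = {}"
  shows "induced_matching (arcs_between G A B) M \<longleftrightarrow>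
    M \<subseteq> parcs G \<inter> A \<times> B \<and> (\<forall>e\<in>M. \<forall>f\<in>M. e \<noteq> f \<longrightarrow> (fst e, snd f) \<notin> parcs G)"
    (is "?L \<longleftrightarrow> ?R")
proof
  assume L: ?L
  then have sub: "M \<subseteq> parcs G \<inter> A \<times> B"
    by (simp add: induced_matching_def arcs_between_def)
  moreover have "(fst e, snd f) \<notin> parcs G" if "e \<in> M" "f \<in> M" "e \<noteq> f" for e f
  proof
    assume "(fst e, snd f) \<in> parcs G"
    moreover have "fst e \<in> A" "snd f \<in> B"
      using sub that by auto
    ultimately have "(fst e, snd f) \<in> parcs (arcs_between G A B)"
      by (simp add: arcs_between_def)
    then show False
      using L that unfolding induced_matching_def endpoints_def by fastforce
  qed
  ultimately show ?R by blast
next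
  assume R: ?R
  show ?L
    unfolding induced_matching_def
  proof (intro conjI ballI impI)
    show "M \<subseteq> parcs (arcs_between G A B)"
      using R by (simp add: arcs_between_def)
  next
    fix e f assume ef: "e \<in> M" "f \<in> M" "e \<noteq> f"
    obtain a b a' b' where [simp]: "e = (a, b)" "f = (a', b')"
      by (cases e, cases f) auto
    have mem: "(a, b) \<in> parcs G" "(a', b') \<in> parcs G" "a \<in> A" "a' \<in> A" "b \<in> B" "b' \<in> B"
      using R ef by auto
    have no: "(a, b') \<notin> parcs G" "(a', b) \<notin> parcs G"
      using R ef by force+
    show "endpoints e \<inter> endpoints f = {}"
      using mem no assms by (auto simp: endpoints_def)
    show "\<not> (\<exists>g\<in>parcs (arcs_between G A B).
        endpoints g \<inter> endpoints e \<noteq> {} \<and> endpoints g \<inter> endpoints f \<noteq> {})"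
      using mem no assms by (auto simp: endpoints_def arcs_between_def)
  qed
qed

lemma finite_induced_matchings:
  assumes "finite (parcs H)"
  shows "finite {M. induced_matching H M}"
  using assms by (auto simp: induced_matching_def intro: finite_subset[of _ "Pow (parcs H)"])

lemma card_le_induced_matching_number:
  assumes "finite (parcs H)" "induced_matching H M"
  shows "card M \<le> induced_matching_number H"
  using assms finite_induced_matchings[OF assms(1)]
  by (auto simp: induced_matching_number_def intro!: Max_ge)

lemma induced_matching_number_leI:
  assumes "finite (parcs H)" "\<And>M. induced_matching H M \<Longrightarrow> card M \<le> k"
  shows "induced_matching_number H \<le> k"
proof -
  have "induced_matching H {}"
    by (simp add: induced_matching_def)
  then show ?thesis
    unfolding induced_matching_number_def
    using assms finite_induced_matchings[OF assms(1)] by (subst Max_le_iff) auto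
qed

section \<open>Walks and powers\<close>

lemma pverts_digraph_power [simp]: "pverts (digraph_power G r) = pverts G"
  by (simp add: digraph_power_def)

lemma finite_parcs_digraph_power:
  assumes "pair_fin_digraph G"
  shows "finite (parcs (digraph_power G r))"
proof -
  interpret pair_fin_digraph G by fact
  have "parcs (digraph_power G r) \<subseteq> pverts G \<times> pverts G"
    by (auto simp: digraph_power_def dest: in_arcsD1 in_arcsD2)
  then show ?thesis
    using pair_finite_verts by (meson finite_SigmaI finite_subset)
qed

context pair_wf_digraph
begin

lemma awalk_imp_relpow: "awalk u p v \<Longrightarrow> (u, v) \<in> parcs G ^^ length p"
proof (induction p arbitrary: u)
  case Nil
  then show ?case by (simp add: awalk_Nil_iff)
next
  case (Cons e p)
  then show ?case
    by (cases e) (auto simp: awalk_Cons_iff simp del: relpow.simps intro: relpow_Suc_I2)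
qed

lemma relpow_imp_awalk:
  "(u, v) \<in> parcs G ^^ n \<Longrightarrow> u \<in> pverts G \<Longrightarrow> \<exists>p. awalk u p v \<and> length p = n"
proof (induction n arbitrary: u)
  case 0
  then show ?case by (auto simp: awalk_Nil_iff)
next
  case (Suc n)
  then obtain z where z: "(u, z) \<in> parcs G" "(z, v) \<in> parcs G ^^ n"
    by (blast dest: relpow_Suc_D2)
  then obtain p where "awalk z p v" "length p = n"
    using Suc.IH in_arcsD2 by blast
  then have "awalk u ((u, z) # p) v \<and> length ((u, z) # p) = Suc n"
    using z by (simp add: awalk_Cons_iff)
  then show ?case by blast
qed

lemma awalk_imp_apath_length_le:
  "awalk u p v \<Longrightarrow> \<exists>q. apath u q v \<and> length q \<le> length p"
proof (induction rule: awalk_to_apath_induct)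
  case (path p)
  then show ?case by (auto simp: apath_def)
next
  case (decomp p q r s)
  then have "length (q @ s) \<le> length p"
    by (auto elim!: awalk_cyc_decompE)
  with decomp show ?case by (meson order_trans)
qed

text \<open>
  Concatenating paths need not give a path, whereas powers of the arc relation compose freely;
  since every walk can be shortened to a path with the same ends, both describe the same arcs
  between distinct vertices.
\<close>

lemma parcs_digraph_power_iff:
  assumes "x \<noteq> y" "0 < r"
  shows "(x, y) \<in> parcs (digraph_power G r) \<longleftrightarrow>
    x \<in> pverts G \<and> (\<exists>n\<le>r. (x, y) \<in> parcs G ^^ n)"
proof
  assume "(x, y) \<in> parcs (digraph_power G r)"
  then consider "(x, y) \<in> parcs G"
    | p where "x \<in> pverts G" "apath x p y" "length p \<le> r"
    by (auto simp: digraph_power_def)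
  then show "x \<in> pverts G \<and> (\<exists>n\<le>r. (x, y) \<in> parcs G ^^ n)"
  proof cases
    case 1
    then have "(x, y) \<in> parcs G ^^ 1" by simp
    then show ?thesis
      using 1 assms in_arcsD1 by (metis Suc_leI One_nat_def)
  next
    case 2
    then show ?thesis
      using awalk_imp_relpow awalkI_apath by blast
  qed
next
  assume "x \<in> pverts G \<and> (\<exists>n\<le>r. (x, y) \<in> parcs G ^^ n)"
  then obtain p where p: "awalk x p y" "length p \<le> r"
    using relpow_imp_awalk by blast
  then obtain q where "apath x q y" "length q \<le> r"
    using awalk_imp_apath_length_le order_trans by blast
  moreover have "x \<in> pverts G" "y \<in> pverts G"
    using p awalk_hd_in_verts awalk_last_in_verts by blast+
  ultimately show "(x, y) \<in> parcs (digraph_power G r)"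
    by (auto simp: digraph_power_def)
qed

end

lemma relpow_crosses_cut:
  assumes "(a, b) \<in> R ^^ n" "a \<in> A" "b \<notin> A"
  shows "\<exists>i j x y. i + Suc j = n \<and> (a, x) \<in> R ^^ i \<and> (x, y) \<in> R \<and> x \<in> A \<and> y \<notin> A \<and>
    (y, b) \<in> R ^^ j"
  using assms
proof (induction n arbitrary: b)
  case 0
  then show ?case by simp
next
  case (Suc n)
  then obtain c where c: "(a, c) \<in> R ^^ n" "(c, b) \<in> R" by auto
  show ?case
  proof (cases "c \<in> A")
    case True
    then have "n + Suc 0 = Suc n \<and> (a, c) \<in> R ^^ n \<and> (c, b) \<in> R \<and> c \<in> A \<and> b \<notin> A \<and>
        (b, b) \<in> R ^^ 0"
      using c Suc.prems by simp
    then show ?thesis by blast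
  next
    case False
    then obtain i j x y where "i + Suc j = n" "(a, x) \<in> R ^^ i" "(x, y) \<in> R" "x \<in> A" "y \<notin> A"
        "(y, c) \<in> R ^^ j"
      using Suc.IH[OF c(1) Suc.prems(2)] by blast
    moreover from this have "(y, b) \<in> R ^^ Suc j"
      using c(2) by auto
    ultimately show ?thesis
      by (metis add_Suc_right)
  qed
qed

section \<open>Matchings in the power\<close>

text \<open>
  Sorting the arcs of the matching by the position of their crossing arc is what makes the lengths
  add up: exchanging the initial parts of two walks that cross at the same position preserves their
  lengths, so the bound \<open>r\<close> survives.
\<close>

lemma induced_matching_number_power_le:
  assumes G: "pair_fin_digraph G" and "0 < r" and A: "A \<subseteq> pverts G"
  shows "induced_matching_number (arcs_between (digraph_power G r) A (pverts G - A))
    \<le> r * induced_matching_number (arcs_between G A (pverts G - A))"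
    (is "induced_matching_number ?HP \<le> r * induced_matching_number ?H")
proof (rule induced_matching_number_leI)
  interpret pair_fin_digraph G by fact
  let ?R = "parcs G" and ?B = "pverts G - A"
  show "finite (parcs ?HP)"
    using finite_parcs_digraph_power[OF G] by (simp add: arcs_between_def)
  have finH: "finite (parcs ?H)"
    using pair_finite_arcs by (simp add: arcs_between_def)
  fix M assume M: "induced_matching ?HP M"
  then have M_sub: "M \<subseteq> parcs (digraph_power G r) \<inter> A \<times> ?B"
    and M_ind: "\<And>e f. e \<in> M \<Longrightarrow> f \<in> M \<Longrightarrow> (fst e, snd f) \<in> parcs (digraph_power G r) \<Longrightarrow> e = f"
    by (auto simp: induced_matching_arcs_between_iff)
  have crossing: "\<exists>i x y j. i + Suc j \<le> r \<and> (fst e, x) \<in> ?R ^^ i \<and> (x, y) \<in> ?R \<and> x \<in> A \<and> y \<in> ?B \<and>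
      (y, snd e) \<in> ?R ^^ j" if e: "e \<in> M" for e
  proof -
    have ends: "fst e \<in> A" "snd e \<in> ?B" "(fst e, snd e) \<in> parcs (digraph_power G r)"
      using M_sub e by auto
    then have "fst e \<noteq> snd e" by auto
    then obtain n where "n \<le> r" "(fst e, snd e) \<in> ?R ^^ n"
      using parcs_digraph_power_iff[OF _ \<open>0 < r\<close>] ends(3) by blast
    then show ?thesis
      using relpow_crosses_cut[of "fst e" "snd e" n ?R A] ends in_arcsD2 by blast
  qed
  then obtain pos x y rest where cross: "\<And>e. e \<in> M \<Longrightarrow> pos e + Suc (rest e) \<le> r \<and>
      (fst e, x e) \<in> ?R ^^ pos e \<and> (x e, y e) \<in> ?R \<and> x e \<in> A \<and> y e \<in> ?B \<and>
      (y e, snd e) \<in> ?R ^^ rest e"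
    by metis
  \<comment> \<open>Switching from the walk of \<open>e\<close> to that of \<open>f\<close> along an arc from \<open>x e\<close> to \<open>y f\<close> yields a
      walk exactly as long as that of \<open>f\<close>.\<close>
  have exchange: "e = f" if "e \<in> M" "f \<in> M" "pos e = pos f" "(x e, y f) \<in> ?R" for e f
  proof (rule M_ind[OF that(1,2)])
    have "(x e, snd f) \<in> ?R ^^ Suc (rest f)"
      using that(4) cross[OF that(2)] by (blast intro: relpow_Suc_I2)
    then have "(fst e, snd f) \<in> ?R ^^ (pos e + Suc (rest f))"
      using cross[OF that(1)] unfolding relpow_add by blast
    moreover have "pos e + Suc (rest f) \<le> r"
      using cross[OF that(2)] that(3) by simp
    ultimately have walk: "\<exists>n\<le>r. (fst e, snd f) \<in> ?R ^^ n"
      by (intro exI conjI)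
    have "fst e \<in> A" "snd f \<in> ?B"
      using M_sub that by auto
    then have "fst e \<noteq> snd f" "fst e \<in> pverts G"
      using A by auto
    then show "(fst e, snd f) \<in> parcs (digraph_power G r)"
      using parcs_digraph_power_iff \<open>0 < r\<close> walk by simp
  qed
  have class_le: "card {e \<in> M. pos e = i} \<le> induced_matching_number ?H" for i
  proof -
    let ?C = "{e \<in> M. pos e = i}" and ?cr = "\<lambda>e. (x e, y e)"
    have "inj_on ?cr ?C"
    proof (rule inj_onI)
      fix e f assume "e \<in> ?C" "f \<in> ?C" "?cr e = ?cr f"
      then show "e = f"
        using exchange[of e f] cross[of f] by auto
    qed
    then have "card ?C = card (?cr ` ?C)"
      by (simp add: card_image)
    moreover have "induced_matching ?H (?cr ` ?C)"
    proof (subst induced_matching_arcs_between_iff)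
      show "A \<inter> ?B = {}" by blast
      show "?cr ` ?C \<subseteq> ?R \<inter> A \<times> ?B \<and>
          (\<forall>e\<in>?cr ` ?C. \<forall>f\<in>?cr ` ?C. e \<noteq> f \<longrightarrow> (fst e, snd f) \<notin> ?R)"
      proof (intro conjI ballI impI)
        show "?cr ` ?C \<subseteq> ?R \<inter> A \<times> ?B"
          using cross by auto
      next
        fix e' f' assume "e' \<in> ?cr ` ?C" "f' \<in> ?cr ` ?C" "e' \<noteq> f'"
        then obtain e f where "e \<in> ?C" "f \<in> ?C" "e \<noteq> f" "e' = ?cr e" "f' = ?cr f"
          by blast
        then show "(fst e', snd f') \<notin> ?R"
          using exchange[of e f] by auto
      qed
    qed
    ultimately show ?thesis
      using card_le_induced_matching_number[OF finH, of "?cr ` ?C"] by linarith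
  qed
  have "pos e < r" if "e \<in> M" for e
    using cross[OF that] by simp
  then have "M = (\<Union>i<r. {e \<in> M. pos e = i})"
    by blast
  then have "card M \<le> (\<Sum>i<r. card {e \<in> M. pos e = i})"
    using card_UN_le[of "{..<r}" "\<lambda>i. {e \<in> M. pos e = i}"] by simp
  also have "\<dots> \<le> r * induced_matching_number ?H"
    using sum_bounded_above[of "{..<r}" "\<lambda>i. card {e \<in> M. pos e = i}"] class_le by simp
  finally show "card M \<le> r * induced_matching_number ?H" .
qed

lemma bimim_power_le:
  assumes "pair_fin_digraph G" "0 < r" "A \<subseteq> pverts G"
  shows "bimim (digraph_power G r) A \<le> r * bimim G A"
proof -
  have "pverts G - (pverts G - A) = A"
    using assms(3) by blast
  then show ?thesis
    using induced_matching_number_power_le[OF assms]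
      induced_matching_number_power_le[OF assms(1,2), of "pverts G - A"]
    by (simp add: bimim_def add_mult_distrib2)
qed

section \<open>Branch decompositions of the power\<close>

theorem lemma3p9:
  fixes G :: "'a pair_pre_digraph" and T :: "'b pair_pre_digraph" and L :: "'a \<Rightarrow> 'b"
    and r w :: nat
  assumes "pair_fin_digraph G"
    and "0 < r" and "0 < w"
    and "branch_decomposition G T L"
    and "bi_mim_width G T L = w"
  shows "branch_decomposition (digraph_power G r) T L \<and>
         bi_mim_width (digraph_power G r) T L \<le> r * w"
proof
  show "branch_decomposition (digraph_power G r) T L"
    using assms(4) by (simp add: branch_decomposition_def)
  have "pair_graph T"
    using assms(4) by (simp add: branch_decomposition_def subcubic_tree_def undirected_tree_def)
  then interpret T: pair_graph T .
  have same_cut: "cut_side (digraph_power G r) T L e = cut_side G T L e" for e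
    by (simp add: cut_side_def)
  have le: "bimim (digraph_power G r) (cut_side G T L e) \<le> r * w" if "e \<in> parcs T" for e
  proof -
    have "bimim G (cut_side G T L e) \<le> w"
      using that T.pair_finite_arcs assms(5) by (auto simp: bi_mim_width_def intro!: Max_ge)
    moreover have "cut_side G T L e \<subseteq> pverts G"
      by (auto simp: cut_side_def)
    ultimately show ?thesis
      using bimim_power_le[OF assms(1,2)] by (meson le_trans mult_le_mono2)
  qed
  show "bi_mim_width (digraph_power G r) T L \<le> r * w"
  proof (cases "parcs T = {}")
    case True
    \<comment> \<open>The maximum of the empty set is an unspecified number, but the same one for \<open>G\<close> and its
        power.\<close>
    then have "bi_mim_width (digraph_power G r) T L = w"
      using assms(5) by (simp add: bi_mim_width_def)
    then show ?thesis
      using \<open>0 < r\<close> by simp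
  next
    case False
    then show ?thesis
      using le T.pair_finite_arcs by (simp add: bi_mim_width_def same_cut)
  qed
qed

end
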